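(* For every integer $k\geq 2$ there exists a $(k+1)$-colored digraph $D$ that has no $k$-colored kernel.
   Context: Digraphs are finite, nonempty, without loops or parallel arcs (pairs of opposite arcs are allowed); $V(D)$ and $A(D)$ denote the vertex and arc sets of $D$. A digraph $D$ is $m$-colored ($m$ a positive integer) if its arcs are colored with $m$ colors (each arc receives one color; no properness condition). Directed paths have no repeated vertices. For a positive integer $j$, a directed path is $j$-colored if its arcs use exactly $j$ colors; $u\leadsto_j v$ denotes a $j$-colored directed path from $u$ to $v$. For a positive integer $k$, a nonempty set $K\subseteq V(D)$ is a $k$-colored kernel of $D$ if it is both: (a) $k$-colored absorbent: for every $u\in V(D)\setminus K$ there exist $v\in K$ and $1\leq j\leq k$ with a path $u\leadsto_j v$ in $D$; and (b) $k$-colored independent: for all distinct $u,v\in K$ there is no path $u\leadsto_j v$ with $1\leq j\leq k$. *)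

theory Defs
  imports "Graph_Theory.Graph_Theory"
begin

(* The library locale digraph provides finiteness and excludes loops and parallel arcs, but
   admits the null digraph; hence the nonemptiness condition. All m colors are required
   to occur, in line with j-colored paths, which use exactly j colors. *)
definition m_colored_digraph :: "nat \<Rightarrow> ('a, 'b) pre_digraph \<Rightarrow> ('b \<Rightarrow> nat) \<Rightarrow> bool" where
  "m_colored_digraph m D c \<longleftrightarrow>
     0 < m \<and> digraph D \<and> verts D \<noteq> {} \<and> c ` arcs D = {1..m}"

definition colored_path ::
  "('a, 'b) pre_digraph \<Rightarrow> ('b \<Rightarrow> nat) \<Rightarrow> nat \<Rightarrow> 'a \<Rightarrow> 'b awalk \<Rightarrow> 'a \<Rightarrow> bool" where
  "colored_path D c j u p v \<longleftrightarrow> pre_digraph.apath D u p v \<and> card (c ` set p) = j"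

definition colored_absorbent ::
  "nat \<Rightarrow> ('a, 'b) pre_digraph \<Rightarrow> ('b \<Rightarrow> nat) \<Rightarrow> 'a set \<Rightarrow> bool" where
  "colored_absorbent k D c K \<longleftrightarrow>
     (\<forall>u \<in> verts D - K. \<exists>v \<in> K. \<exists>j \<in> {1..k}. \<exists>p. colored_path D c j u p v)"

definition colored_independent ::
  "nat \<Rightarrow> ('a, 'b) pre_digraph \<Rightarrow> ('b \<Rightarrow> nat) \<Rightarrow> 'a set \<Rightarrow> bool" where
  "colored_independent k D c K \<longleftrightarrow>
     (\<forall>u \<in> K. \<forall>v \<in> K. u \<noteq> v \<longrightarrow> \<not> (\<exists>j \<in> {1..k}. \<exists>p. colored_path D c j u p v))"

definition colored_kernel ::
  "nat \<Rightarrow> ('a, 'b) pre_digraph \<Rightarrow> ('b \<Rightarrow> nat) \<Rightarrow> 'a set \<Rightarrow> bool" where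
  "colored_kernel k D c K \<longleftrightarrow>
     K \<noteq> {} \<and> K \<subseteq> verts D \<and> colored_absorbent k D c K \<and> colored_independent k D c K"

end

theory Submission
  imports Defs
begin

text \<open>
  Take the directed cycle with \<open>k + 1\<close> consecutive blocks of two arcs, each block having a colour
  of its own. With \<open>k + 1\<close> colours, a path between distinct vertices has at most \<open>k\<close> colours exactly when
  it misses one. Two facts exclude a kernel.

  First, any two distinct vertices are joined, in one direction or the other, by a path that misses
  a colour (lemma \<open>some_path_misses_colour\<close>): the two vertices cut the cycle into two paths, and
  both paths see all colours only if every block is cut in its middle, which two cuts cannot
  achieve for \<open>k + 1 \<ge> 3\<close> blocks. So an independent set has at most one vertex.

  Second, no single vertex \<open>v\<close> absorbs its successor: the only way from the successor back to \<open>v\<close>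
  runs through every arc except the one leaving \<open>v\<close>, and every colour survives the removal of
  one arc (lemma \<open>return_walk_uses_all_colours\<close>). Hence a one-element set is not absorbent.
\<close>

definition directed_cycle :: "nat \<Rightarrow> (nat, nat) pre_digraph" where
  "directed_cycle n = \<lparr>verts = {..<n}, arcs = {..<n}, tail = id, head = (\<lambda>e. Suc e mod n)\<rparr>"

definition block_colour :: "nat \<Rightarrow> nat" where
  "block_colour e = Suc (e div 2)"

lemma directed_cycle_simps [simp]:
  "verts (directed_cycle n) = {..<n}"
  "arcs (directed_cycle n) = {..<n}"
  "tail (directed_cycle n) e = e"
  "head (directed_cycle n) e = Suc e mod n"
  by (simp_all add: directed_cycle_def)

lemma digraph_directed_cycle:
  assumes "2 \<le> n"
  shows "digraph (directed_cycle n)"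
proof
  fix e assume "e \<in> arcs (directed_cycle n)"
  then show "tail (directed_cycle n) e \<noteq> head (directed_cycle n) e"
    using assms by (cases "Suc e = n") auto
qed (use assms in \<open>auto simp: arc_to_ends_def\<close>)

lemma block_colours_directed_cycle:
  "block_colour ` arcs (directed_cycle (2 * m)) = {1..m}"
proof
  show "{1..m} \<subseteq> block_colour ` arcs (directed_cycle (2 * m))"
  proof
    fix i assume i: "i \<in> {1..m}"
    then have "i = block_colour (2 * (i - 1))"
      by (simp add: block_colour_def)
    then show "i \<in> block_colour ` arcs (directed_cycle (2 * m))"
      using i by (intro image_eqI[of _ _ "2 * (i - 1)"]) auto
  qed
qed (auto simp: block_colour_def)

definition cycle_arcs :: "nat \<Rightarrow> nat \<Rightarrow> nat \<Rightarrow> nat list" where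
  "cycle_arcs n u l = map (\<lambda>i. (u + i) mod n) [0..<l]"

lemma cycle_arcs_Suc: "cycle_arcs n u (Suc l) = (u mod n) # cycle_arcs n (Suc u mod n) l"
  unfolding cycle_arcs_def
  by (simp add: upt_conv_Cons map_Suc_upt[symmetric] mod_simps del: upt_Suc)

text \<open>Every vertex has out-degree one, so a walk is determined by its start and its length.\<close>

lemma awalk_directed_cycleD:
  assumes "pre_digraph.awalk (directed_cycle n) u p v"
  shows "p = cycle_arcs n u (length p) \<and> v = (u + length p) mod n"
proof -
  interpret pre_digraph "directed_cycle n" .
  show ?thesis using assms
  proof (induction p arbitrary: u)
    case Nil
    then show ?case by (auto simp: awalk_def cycle_arcs_def)
  next
    case (Cons e p)
    have e: "e = u" "u < n" and w: "awalk (Suc u mod n) p v"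
      using Cons.prems by (auto simp: awalk_def)
    from Cons.IH[OF w] e show ?case
      by (simp add: cycle_arcs_Suc mod_simps)
  qed
qed

lemma awalk_cycle_arcs:
  assumes "u < n"
  shows "pre_digraph.awalk (directed_cycle n) u (cycle_arcs n u l) ((u + l) mod n)"
proof -
  interpret pre_digraph "directed_cycle n" .
  show ?thesis using assms
  proof (induction l arbitrary: u)
    case 0
    then show ?case by (simp add: awalk_def cycle_arcs_def)
  next
    case (Suc l)
    from Suc.prems have "Suc u mod n < n" by simp
    from Suc.IH[OF this] Suc.prems show ?case
      by (auto simp: cycle_arcs_Suc awalk_def mod_simps)
  qed
qed

text \<open>
  Prefixing the arc out of \<open>v\<close> gives a closed walk, whose length is a positive multiple of
  \<open>2 * m\<close>; so the walk covers all other arcs, among them one from each block.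
\<close>

lemma return_walk_uses_all_colours:
  assumes v: "v < 2 * m"
    and walk: "pre_digraph.awalk (directed_cycle (2 * m)) (Suc v mod (2 * m)) p v"
  shows "{1..m} \<subseteq> block_colour ` set p"
proof
  let ?n = "2 * m"
  have p: "p = cycle_arcs ?n (Suc v mod ?n) (length p)"
    and "v = (Suc v mod ?n + length p) mod ?n"
    using awalk_directed_cycleD[OF walk] by auto
  then have "(v + Suc (length p)) mod ?n = (v + 0) mod ?n"
    using v by (simp add: mod_simps)
  then have "?n dvd Suc (length p)"
    by (metis add_diff_cancel_left' le_add1 mod_eq_dvd_iff_nat add.right_neutral)
  then have len: "?n \<le> Suc (length p)"
    by (rule dvd_imp_le) simp
  have arc: "e \<in> set p" if "e < ?n" "e \<noteq> v" for e
  proof -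
    \<comment> \<open>the number of steps from the successor of \<open>v\<close> to the tail of \<open>e\<close>\<close>
    define i where "i = (if v < e then e - Suc v else e + ?n - Suc v)"
    have "i < length p" "(Suc v mod ?n + i) mod ?n = e"
      using that v len by (auto simp: i_def mod_simps)
    then show ?thesis
      by (subst p) (force simp: cycle_arcs_def)
  qed
  fix i assume i: "i \<in> {1..m}"
  let ?e = "2 * (i - 1)"
  have "block_colour ?e = i" "block_colour (Suc ?e) = i" "Suc ?e < ?n"
    using i by (auto simp: block_colour_def)
  moreover have "?e \<noteq> v \<or> Suc ?e \<noteq> v"
    by auto
  ultimately show "i \<in> block_colour ` set p"
    using arc[of ?e] arc[of "Suc ?e"] by (metis Suc_lessD image_eqI)
qed

text \<open>Shortening a walk to a path only loses colours, so walks suffice to refute independence.\<close>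

lemma colored_path_if_awalk_misses_colour:
  assumes D: "m_colored_digraph (k + 1) D c"
    and walk: "pre_digraph.awalk D u p v" and "u \<noteq> v"
    and i: "i \<in> {1..k + 1}" "i \<notin> c ` set p"
  shows "\<exists>j\<in>{1..k}. \<exists>q. colored_path D c j u q v"
proof -
  interpret digraph D
    using D by (simp add: m_colored_digraph_def)
  let ?q = "awalk_to_apath p"
  have q: "apath u ?q v" and sub: "set ?q \<subseteq> set p"
    using walk by (auto intro: apath_awalk_to_apath dest: awalk_to_apath_subset)
  have "set ?q \<subseteq> arcs D"
    using q by (auto simp: apath_def awalk_def)
  then have "c ` set ?q \<subseteq> {1..k + 1}"
    using D unfolding m_colored_digraph_def by (metis image_mono)
  then have "c ` set ?q \<subseteq> {1..k + 1} - {i}"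
    using sub i by blast
  then have "card (c ` set ?q) \<le> card ({1..k + 1} - {i})"
    by (intro card_mono) auto
  also have "\<dots> = k"
    using i by simp
  finally have "card (c ` set ?q) \<le> k" .
  moreover have "?q \<noteq> []"
    using q \<open>u \<noteq> v\<close> by (auto simp: apath_def awalk_def)
  then have "1 \<le> card (c ` set ?q)"
    by (simp add: Suc_le_eq card_gt_0_iff)
  ultimately have "card (c ` set ?q) \<in> {1..k}"
    by simp
  with q show ?thesis
    unfolding colored_path_def by blast
qed

lemma some_path_misses_colour:
  assumes k: "2 \<le> k" and uv: "u < v" "v < 2 * (k + 1)"
    and D: "m_colored_digraph (k + 1) (directed_cycle (2 * (k + 1))) block_colour"
      (is "m_colored_digraph _ ?D _")
  shows "(\<exists>j\<in>{1..k}. \<exists>p. colored_path ?D block_colour j u p v) \<or>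
    (\<exists>j\<in>{1..k}. \<exists>p. colored_path ?D block_colour j v p u)"
proof -
  let ?n = "2 * (k + 1)"
  let ?p = "cycle_arcs ?n u (v - u)"
  let ?q = "cycle_arcs ?n v (?n - v + u)"
  have p: "pre_digraph.awalk ?D u ?p v"
    using awalk_cycle_arcs[of u ?n "v - u"] uv by simp
  have q: "pre_digraph.awalk ?D v ?q u"
  proof -
    have "v + (?n - v + u) = u + ?n" "u < ?n"
      using uv by simp_all
    then have "(v + (?n - v + u)) mod ?n = u"
      by (metis mod_add_self2 mod_less)
    then show ?thesis
      using awalk_cycle_arcs[OF uv(2), of "?n - v + u"] by simp
  qed
  have set_p: "set ?p = {u..<v}"
    using uv by (auto simp: cycle_arcs_def image_iff Bex_def intro: exI[of _ "_ - u"])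
  consider "2 \<le> u" | "v \<le> 2 * k" | "u < 2" "2 * k < v"
    by linarith
  then show ?thesis
  proof cases
    case 1
    then have "1 \<notin> block_colour ` set ?p"
      unfolding set_p using uv by (auto simp: block_colour_def)
    then show ?thesis
      using colored_path_if_awalk_misses_colour[OF D p, of 1] uv by auto
  next
    case 2
    then have "k + 1 \<notin> block_colour ` set ?p"
      unfolding set_p using uv by (auto simp: block_colour_def)
    then show ?thesis
      using colored_path_if_awalk_misses_colour[OF D p, of "k + 1"] uv by auto
  next
    case 3
    \<comment> \<open>The path from \<open>u\<close> to \<open>v\<close> contains the whole block of colour 2, arcs 2 and 3.\<close>
    have "block_colour ((v + i) mod ?n) \<noteq> 2" if "i < ?n - v + u" for i
    proof (cases "v + i < ?n")
      case True
      then show ?thesis using 3 k by (simp add: block_colour_def)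
    next
      case False
      then have "(v + i) mod ?n = v + i - ?n"
        using that uv by (simp add: mod_if)
      moreover have "v + i - ?n < 2"
        using that 3 uv by linarith
      ultimately show ?thesis by (simp add: block_colour_def)
    qed
    then have "2 \<notin> block_colour ` set ?q"
      by (fastforce simp: cycle_arcs_def)
    then show ?thesis
      using colored_path_if_awalk_misses_colour[OF D q, of 2] uv k by auto
  qed
qed

theorem theorem6:
  fixes k :: nat
  assumes "k \<ge> 2"
  shows "\<exists>(D :: (nat, nat) pre_digraph) (c :: nat \<Rightarrow> nat).
    m_colored_digraph (k + 1) D c \<and> \<not> (\<exists>K. colored_kernel k D c K)"
proof (intro exI conjI notI)
  let ?n = "2 * (k + 1)"
  let ?D = "directed_cycle ?n"
  show D: "m_colored_digraph (k + 1) ?D block_colour"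
    unfolding m_colored_digraph_def
    using block_colours_directed_cycle[of "k + 1"] digraph_directed_cycle[of ?n]
    by (auto simp: lessThan_empty_iff)
  assume "\<exists>K. colored_kernel k ?D block_colour K"
  then obtain K where K: "K \<noteq> {}" "K \<subseteq> {..<?n}"
    and absorb: "colored_absorbent k ?D block_colour K"
    and indep: "colored_independent k ?D block_colour K"
    by (auto simp: colored_kernel_def)
  have False if "u \<in> K" "v \<in> K" "u < v" for u v
    using some_path_misses_colour[OF assms \<open>u < v\<close> _ D] that K indep
    unfolding colored_independent_def by (metis lessThan_iff less_irrefl subsetD)
  then have unique: "u = v" if "u \<in> K" "v \<in> K" for u v
    using that by (metis linorder_neqE_nat)
  obtain v where v: "v \<in> K" "v < ?n"
    using K by auto
  have "Suc v mod ?n \<noteq> v"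
    using v by (cases "Suc v = ?n") auto
  then have "Suc v mod ?n \<in> verts ?D - K"
    using unique v by auto
  then obtain j p where "j \<in> {1..k}" and p: "colored_path ?D block_colour j (Suc v mod ?n) p v"
    using absorb unique[OF _ \<open>v \<in> K\<close>] unfolding colored_absorbent_def by metis
  then have "pre_digraph.awalk ?D (Suc v mod ?n) p v" "card (block_colour ` set p) \<le> k"
    by (auto simp: colored_path_def pre_digraph.apath_def)
  moreover have "k + 1 \<le> card (block_colour ` set p)"
    using card_mono[OF _ return_walk_uses_all_colours[OF v(2) calculation(1)]] by simp
  ultimately show False by simp
qed

end
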